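(* Let $\|\cdot\|_X$ be a norm on $\mathbb{R}^2$ whose unit ball $BX$ is a regular polygon. Then there is a well-distributed set $S\subset X$ such that $$|\Delta_{X,N}(S)|=O(N)\quad(N\to\infty).$$
   Context: $X$ denotes $\mathbb{R}^2$ equipped with the norm $\|\cdot\|_X$, and $BX=\{x:\|x\|_X\le 1\}$; "regular" is in the usual Euclidean sense. A set $S\subset X$ is well-distributed if there is a constant $K$ such that for every $x\in X$ there is $y\in S$ with $\|x-y\|_X\le K$. For a positive integer $N$ and $A\subset X$, $\Delta_{X,N}(A)$ is the set of all numbers $\|a-a'\|_X$ with $a,a'\in A$ and $\|a-a'\|_X\le N$; $|\cdot|$ denotes cardinality, and $N$ runs over positive integers. *)

theory Defs
  imports "HOL-Analysis.Analysis" "HOL-Library.Landau_Symbols"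
begin

definition is_norm :: "('a::real_vector \<Rightarrow> real) \<Rightarrow> bool" where
  "is_norm nrm \<longleftrightarrow>
     (\<forall>x. nrm x \<ge> 0) \<and>
     (\<forall>x. nrm x = 0 \<longleftrightarrow> x = 0) \<and>
     (\<forall>c x. nrm (c *\<^sub>R x) = \<bar>c\<bar> * nrm x) \<and>
     (\<forall>x y. nrm (x + y) \<le> nrm x + nrm y)"

definition unit_ball :: "('a::real_vector \<Rightarrow> real) \<Rightarrow> 'a set" where
  "unit_ball nrm = {x. nrm x \<le> 1}"

text \<open>The Euclidean angle at \<open>b\<close> between the rays towards \<open>a\<close> and \<open>c\<close>.\<close>

definition angle_at :: "'a::real_inner \<Rightarrow> 'a \<Rightarrow> 'a \<Rightarrow> real" where
  "angle_at a b c = arccos (inner (a - b) (c - b) / (norm (a - b) * norm (c - b)))"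

text \<open>\<open>P\<close> is a convex \<open>n\<close>-gon with vertices \<open>v 0, \<dots>, v (n - 1)\<close> in cyclic order. Since the
  vertices are distinct and consecutive ones span edges, they are all extreme points of \<open>P\<close> and
  these are all the edges of \<open>P\<close>. The degenerate (collinear) case is excluded, since a segment
  has only one edge.\<close>

definition convex_polygon :: "nat \<Rightarrow> (nat \<Rightarrow> real^2) \<Rightarrow> (real^2) set \<Rightarrow> bool" where
  "convex_polygon n v P \<longleftrightarrow>
     n \<ge> 3 \<and> inj_on v {..<n} \<and> P = convex hull (v ` {..<n}) \<and>
     (\<forall>i<n. closed_segment (v i) (v (Suc i mod n)) edge_of P)"

text \<open>All sides have equal Euclidean length and all interior angles are equal.\<close>

definition regular_polygon :: "(real^2) set \<Rightarrow> bool" where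
  "regular_polygon P \<longleftrightarrow>
     (\<exists>n v. convex_polygon n v P \<and>
        (\<exists>s. \<forall>i<n. dist (v i) (v (Suc i mod n)) = s) \<and>
        (\<exists>\<theta>. \<forall>i<n. angle_at (v i) (v (Suc i mod n)) (v (Suc (Suc i) mod n)) = \<theta>))"

definition well_distributed :: "('a::real_vector \<Rightarrow> real) \<Rightarrow> 'a set \<Rightarrow> bool" where
  "well_distributed nrm S \<longleftrightarrow> (\<exists>K. \<forall>x. \<exists>y\<in>S. nrm (x - y) \<le> K)"

definition dist_set :: "('a::real_vector \<Rightarrow> real) \<Rightarrow> nat \<Rightarrow> 'a set \<Rightarrow> real set" where
  "dist_set nrm N A =
     {nrm (a - a') | a a'. a \<in> A \<and> a' \<in> A \<and> nrm (a - a') \<le> real N}"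

end

theory Submission
  imports Defs
begin

text \<open>Let \<open>D\<close> be the set of edge vectors of the polygon. Every value \<open>nrm x\<close> has the form
  \<open>\<bar>x \<bullet> w\<bar>\<close> with \<open>w\<close> a scaled edge normal, and the reflections in the lines orthogonal to the
  \<open>w\<close> permute \<open>D\<close>. Take \<open>S\<close> to be the cut-and-project set of all integer combinations
  \<open>\<Sum>v\<in>D. x v *\<^sub>R v\<close> whose coefficient vector \<open>x\<close> is close to \<open>v \<mapsto> z \<bullet> v\<close> for some \<open>z\<close>; it is
  well-distributed since \<open>z \<mapsto> \<Sum>v\<in>D. (z \<bullet> v) *\<^sub>R v\<close> is onto. Pairing \<open>v\<close> with its mirror
  image \<open>v'\<close> under the reflection of \<open>w\<close> turns the inner product with \<open>w\<close> into
  \<open>1/2 * (\<Sum>v\<in>D. (x v - x v') * (v \<bullet> w))\<close>, and the integers \<open>x v - x v'\<close> are within a bounded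
  distance of the single line \<open>t \<mapsto> (v \<mapsto> t * (v \<bullet> w))\<close>. There are only \<open>O(N)\<close> integer vectors
  near a segment of length \<open>O(N)\<close> on a line.\<close>

section \<open>Counting values of a linear form at integer vectors near a point or a line\<close>

text \<open>Each coordinate is confined to an interval of length \<open>2 * B\<close>, which holds
  at most \<open>2 * B + 1\<close> integers, so \<open>Y\<close> is covered by the image of a finite
  box.\<close>

lemma card_near_point:
  fixes c p :: "'v \<Rightarrow> real"
  assumes "finite V" "B \<ge> 0"
  defines "Y \<equiv> {\<Sum>v\<in>V. of_int (y v) * c v | y :: 'v \<Rightarrow> int. \<forall>v\<in>V. \<bar>of_int (y v) - p v\<bar> \<le> B}"
  shows "finite Y" "real (card Y) \<le> (2 * B + 1) ^ card V"
proof -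
  define I where "I v = {\<lceil>p v - B\<rceil>..\<lfloor>p v + B\<rfloor>}" for v
  define F where "F = (\<lambda>y :: 'v \<Rightarrow> int. \<Sum>v\<in>V. of_int (y v) * c v)"
  have sub: "Y \<subseteq> F ` PiE V I"
  proof
    fix r assume "r \<in> Y"
    then obtain y where y: "r = F y" "\<forall>v\<in>V. \<bar>of_int (y v) - p v\<bar> \<le> B"
      unfolding Y_def F_def by blast
    \<comment> \<open>Off \<open>V\<close> the function \<open>y\<close> is arbitrary; restricting
      it does not change the sum and puts it into the finite set of extensional functions.\<close>
    have "restrict y V \<in> PiE V I"
      using y(2) by (fastforce simp: I_def ceiling_le_iff le_floor_iff abs_le_iff)
    moreover have "r = F (restrict y V)" using y(1) by (simp add: F_def)
    ultimately show "r \<in> F ` PiE V I" by blast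
  qed
  have fin: "finite (PiE V I)" using assms(1) by (intro finite_PiE) (auto simp: I_def)
  then show "finite Y" using sub finite_surj by blast
  have cI: "real (card (I v)) \<le> 2 * B + 1" for v
  proof -
    have "real_of_int (\<lfloor>p v + B\<rfloor> - \<lceil>p v - B\<rceil>) \<le> 2 * B"
      using of_int_floor_le[of "p v + B"] le_of_int_ceiling[of "p v - B"] by linarith
    then show ?thesis using assms(2) by (auto simp: I_def)
  qed
  have "card Y \<le> card (F ` PiE V I)" using sub fin by (intro card_mono) auto
  also have "\<dots> \<le> card (PiE V I)" using fin by (rule card_image_le)
  finally have "real (card Y) \<le> (\<Prod>v\<in>V. real (card (I v)))"
    using assms(1) by (simp add: card_PiE flip: of_nat_prod)
  also have "\<dots> \<le> (\<Prod>v\<in>V. 2 * B + 1)" by (intro prod_mono) (auto simp: cI)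
  finally show "real (card Y) \<le> (2 * B + 1) ^ card V" by simp
qed

text \<open>The sum differs from \<open>t * q\<close> by at most \<open>B * m\<close>, so
  \<open>\<bar>r\<bar> \<le> T\<close> confines \<open>t\<close> to an interval of length
  \<open>O(T)\<close>. Rounding \<open>t\<close> down moves each \<open>t * c v\<close> by at most
  \<open>m\<close>, so \<open>O(T)\<close> uses of the point bound with tolerance
  \<open>B + m\<close> suffice.\<close>

lemma card_near_line:
  fixes c :: "'v \<Rightarrow> real"
  assumes "finite V" "B \<ge> 0" "v0 \<in> V" "c v0 \<noteq> 0"
  obtains K where
    "\<And>T. T \<ge> 1 \<Longrightarrow>
      finite {r. (\<exists>(y :: 'v \<Rightarrow> int) t. r = (\<Sum>v\<in>V. of_int (y v) * c v) \<and>
                    (\<forall>v\<in>V. \<bar>of_int (y v) - t * c v\<bar> \<le> B)) \<and> \<bar>r\<bar> \<le> T}"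
    "\<And>T. T \<ge> 1 \<Longrightarrow>
      real (card {r. (\<exists>(y :: 'v \<Rightarrow> int) t. r = (\<Sum>v\<in>V. of_int (y v) * c v) \<and>
                    (\<forall>v\<in>V. \<bar>of_int (y v) - t * c v\<bar> \<le> B)) \<and> \<bar>r\<bar> \<le> T}) \<le> K * T"
proof -
  define q where "q = (\<Sum>v\<in>V. (c v)\<^sup>2)"
  define m where "m = (\<Sum>v\<in>V. \<bar>c v\<bar>)"
  define C where "C = (2 * (B + m) + 1) ^ card V"
  define Y where "Y i = {\<Sum>v\<in>V. of_int (y v) * c v | y :: 'v \<Rightarrow> int.
      \<forall>v\<in>V. \<bar>of_int (y v) - of_int i * c v\<bar> \<le> B + m}" for i :: int
  have q: "q > 0"
    unfolding q_def using assms by (intro sum_pos2[of V v0]) auto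
  have m: "m \<ge> 0" unfolding m_def by (simp add: sum_nonneg)
  have C: "C \<ge> 0" unfolding C_def using m assms by simp
  have Y: "finite (Y i)" "real (card (Y i)) \<le> C" for i
    using card_near_point[of V "B + m"] assms m unfolding Y_def C_def by auto
  {
    fix T :: real assume T: "T \<ge> 1"
    let ?R = "{r. (\<exists>(y :: 'v \<Rightarrow> int) t. r = (\<Sum>v\<in>V. of_int (y v) * c v) \<and>
                    (\<forall>v\<in>V. \<bar>of_int (y v) - t * c v\<bar> \<le> B)) \<and> \<bar>r\<bar> \<le> T}"
    define b where "b = (T + B * m) / q"
    have b: "b \<ge> 0" using T q m assms unfolding b_def by simp
    have sub: "?R \<subseteq> (\<Union>i\<in>{-\<lceil>b\<rceil>-1..\<lceil>b\<rceil>}. Y i)"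
    proof
      fix r assume "r \<in> ?R"
      then obtain y :: "'v \<Rightarrow> int" and t where r: "r = (\<Sum>v\<in>V. of_int (y v) * c v)" "\<bar>r\<bar> \<le> T"
        and y: "\<And>v. v \<in> V \<Longrightarrow> \<bar>of_int (y v) - t * c v\<bar> \<le> B" by blast
      have "\<bar>r - t * q\<bar> = \<bar>\<Sum>v\<in>V. (of_int (y v) - t * c v) * c v\<bar>"
        by (simp add: r q_def sum_distrib_left sum_subtractf algebra_simps power2_eq_square)
      also have "\<dots> \<le> (\<Sum>v\<in>V. \<bar>(of_int (y v) - t * c v) * c v\<bar>)" by (rule sum_abs)
      also have "\<dots> \<le> (\<Sum>v\<in>V. B * \<bar>c v\<bar>)"
        by (intro sum_mono) (auto simp: abs_mult intro!: mult_right_mono y)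
      also have "\<dots> = B * m" by (simp add: m_def sum_distrib_left)
      finally have "\<bar>t * q\<bar> \<le> T + B * m" using r(2) by linarith
      then have "\<bar>t\<bar> \<le> b" using q by (simp add: b_def abs_mult pos_le_divide_eq)
      then have "\<lfloor>t\<rfloor> \<in> {-\<lceil>b\<rceil>-1..\<lceil>b\<rceil>}" by (auto simp: abs_le_iff) linarith+
      moreover have "r \<in> Y \<lfloor>t\<rfloor>"
      proof -
        have "\<bar>of_int (y v) - of_int \<lfloor>t\<rfloor> * c v\<bar> \<le> B + m" if v: "v \<in> V" for v
        proof -
          have "\<bar>(t - of_int \<lfloor>t\<rfloor>) * c v\<bar> \<le> 1 * \<bar>c v\<bar>"
            unfolding abs_mult by (intro mult_right_mono) linarith+
          also have "\<dots> \<le> m"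
            unfolding m_def using member_le_sum[of v V "\<lambda>v. \<bar>c v\<bar>"] v assms(1) by simp
          finally show ?thesis using y[OF v] by (simp add: algebra_simps) 
        qed
        then show ?thesis unfolding Y_def r(1) by (intro CollectI exI[of _ y]) simp
      qed
      ultimately show "r \<in> (\<Union>i\<in>{-\<lceil>b\<rceil>-1..\<lceil>b\<rceil>}. Y i)" by blast
    qed
    have fin: "finite (\<Union>i\<in>{-\<lceil>b\<rceil>-1..\<lceil>b\<rceil>}. Y i)" using Y(1) by simp
    have "card ?R \<le> card (\<Union>i\<in>{-\<lceil>b\<rceil>-1..\<lceil>b\<rceil>}. Y i)" using sub fin by (rule card_mono[rotated])
    also have "\<dots> \<le> (\<Sum>i\<in>{-\<lceil>b\<rceil>-1..\<lceil>b\<rceil>}. card (Y i))" by (intro card_UN_le) simp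
    finally have "real (card ?R) \<le> (\<Sum>i\<in>{-\<lceil>b\<rceil>-1..\<lceil>b\<rceil>}. real (card (Y i)))"
      unfolding of_nat_sum[symmetric] by (rule of_nat_mono)
    also have "\<dots> \<le> real (card {-\<lceil>b\<rceil>-1..\<lceil>b\<rceil>}) * C"
      by (intro sum_bounded_above Y)
    also have "\<dots> \<le> (2 * b + 4) * C"
    proof (intro mult_right_mono C)
      have "real_of_int \<lceil>b\<rceil> < b + 1" by linarith
      then show "real (card {-\<lceil>b\<rceil>-1..\<lceil>b\<rceil>}) \<le> 2 * b + 4" using b by simp
    qed
    \<comment> \<open>Since \<open>T \<ge> 1\<close>, the terms independent of \<open>T\<close> are
      absorbed into multiples of \<open>T\<close>.\<close>
    also have "\<dots> \<le> (2 * ((1 + B * m) / q) * T + 4 * T) * C"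
    proof (intro mult_right_mono C add_mono)
      have "B * m * 1 \<le> B * m * T" using T m assms by (intro mult_left_mono) auto
      then have "b \<le> (1 + B * m) * T / q" unfolding b_def using q 
        by (intro divide_right_mono) (auto simp: algebra_simps)
      then have "b \<le> (1 + B * m) / q * T" by simp
      then have "2 * b \<le> 2 * ((1 + B * m) / q * T)" by (rule mult_left_mono) simp
      then show "2 * b \<le> 2 * ((1 + B * m) / q) * T" by (simp only: mult.assoc)
    qed (use T in auto)
    finally have "real (card ?R) \<le> ((2 * ((1 + B * m) / q) + 4) * C) * T" by (simp add: algebra_simps)
    moreover have "finite ?R" using sub fin finite_subset by blast
    ultimately have "finite ?R \<and> real (card ?R) \<le> ((2 * ((1 + B * m) / q) + 4) * C) * T" by blast
  }
  note * = this
  show thesis by (rule that[OF conjunct1[OF *] conjunct2[OF *]])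
qed

section \<open>Reflections, frames and the cut-and-project set\<close>

text \<open>The mirror is the hyperplane orthogonal to \<open>w\<close>. For \<open>w = 0\<close>
  division by zero gives the identity, so the involution and sign laws hold for every
  \<open>w\<close>.\<close>

definition reflection :: "'a::real_inner \<Rightarrow> 'a \<Rightarrow> 'a" where
  "reflection w y = y - (2 * (y \<bullet> w) / (w \<bullet> w)) *\<^sub>R w"

lemma reflection_reflection [simp]: "reflection w (reflection w y) = y"
  by (cases "w = 0") (auto simp: reflection_def algebra_simps)

lemma inner_reflection: "reflection w y \<bullet> w = - (y \<bullet> w)"
  by (cases "w = 0") (auto simp: reflection_def algebra_simps)

lemma reflection_scaleR: "c \<noteq> 0 \<Longrightarrow> reflection (c *\<^sub>R w) = reflection w"
  by (auto simp: reflection_def fun_eq_iff)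

text \<open>The frame operator \<open>A\<close> satisfies
  \<open>z \<bullet> A z = (\<Sum>v\<in>V. (z \<bullet> v)\<^sup>2)\<close>, so it is injective when
  \<open>V\<close> spans, and hence onto in finite dimension.\<close>

lemma frame_surj:
  fixes V :: "'a::euclidean_space set"
  assumes "finite V" and span: "\<And>z. (\<And>v. v \<in> V \<Longrightarrow> z \<bullet> v = 0) \<Longrightarrow> z = 0"
  shows "\<exists>z. (\<Sum>v\<in>V. (z \<bullet> v) *\<^sub>R v) = x"
proof -
  define A where "A = (\<lambda>z. \<Sum>v\<in>V. (z \<bullet> v) *\<^sub>R v)"
  have lin: "linear A"
    unfolding A_def
    by (intro linearI) (simp_all add: inner_add_left scaleR_add_left sum.distrib scaleR_sum_right)
  have "inj A"
  proof (subst linear_injective_0[OF lin], intro allI impI)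
    fix z assume "A z = 0"
    then have "z \<bullet> A z = 0" by simp
    then have "(\<Sum>v\<in>V. (z \<bullet> v)\<^sup>2) = 0"
      by (simp add: A_def inner_sum_right power2_eq_square)
    then have "\<forall>v\<in>V. z \<bullet> v = 0" using assms(1) by (simp add: sum_nonneg_eq_0_iff)
    then show "z = 0" by (intro span) blast
  qed
  then have "surj A" using linear_injective_imp_surjective[OF lin] by blast
  then obtain z where "x = A z" by (rule surjE)
  then show ?thesis by (auto simp: A_def)
qed

text \<open>The counting argument in any dimension, separated from polygons: \<open>V\<close> stands
  for the edge vectors and \<open>W\<close> for the scaled normals. As \<open>card\<close> is 0 on
  infinite sets, the finiteness conjunct is what gives the bound its meaning.\<close>

lemma reflection_invariant_distances:
  fixes V W :: "'a::euclidean_space set" and nrm :: "'a \<Rightarrow> real"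
  assumes "finite V" and span: "\<And>z. (\<And>v. v \<in> V \<Longrightarrow> z \<bullet> v = 0) \<Longrightarrow> z = 0"
    and "finite W" "0 \<notin> W"
    and refl: "\<And>v w. v \<in> V \<Longrightarrow> w \<in> W \<Longrightarrow> reflection w v \<in> V"
    and nrm: "\<And>x. \<exists>w\<in>W. nrm x = \<bar>x \<bullet> w\<bar>"
  shows "\<exists>S. well_distributed nrm S \<and>
           (\<forall>N\<ge>1. finite (dist_set nrm N S)) \<and>
           (\<lambda>N. real (card (dist_set nrm N S))) \<in> O(\<lambda>N. real N)"
proof -
  define S where "S = {\<Sum>v\<in>V. of_int (x v) *\<^sub>R v | (x :: 'a \<Rightarrow> int) z.
      \<forall>v\<in>V. \<bar>of_int (x v) - z \<bullet> v\<bar> \<le> 1}"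
  \<comment> \<open>The tolerance 1 of \<open>S\<close> doubles on taking a difference of two points
    and doubles again on subtracting the mirrored coefficient, hence 4.\<close>
  define Y where "Y w T = {r. (\<exists>(y :: 'a \<Rightarrow> int) t. r = (\<Sum>v\<in>V. of_int (y v) * (v \<bullet> w)) \<and>
                    (\<forall>v\<in>V. \<bar>of_int (y v) - t * (v \<bullet> w)\<bar> \<le> 4)) \<and> \<bar>r\<bar> \<le> T}" for w and T :: real
  have "\<forall>w\<in>W. \<exists>K. \<forall>T\<ge>1. finite (Y w T) \<and> real (card (Y w T)) \<le> K * T"
  proof
    fix w assume "w \<in> W"
    then have "w \<noteq> 0" using assms(4) by auto
    then obtain v0 where v0: "v0 \<in> V" "v0 \<bullet> w \<noteq> 0" using span[of w] by (metis inner_commute)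
    show "\<exists>K. \<forall>T\<ge>1. finite (Y w T) \<and> real (card (Y w T)) \<le> K * T"
      by (rule card_near_line[of V 4 v0 "\<lambda>v. v \<bullet> w"]) (use assms(1) v0 in \<open>auto simp: Y_def\<close>)
  qed
  then obtain K where K: "\<And>w T. w \<in> W \<Longrightarrow> T \<ge> 1 \<Longrightarrow> finite (Y w T) \<and> real (card (Y w T)) \<le> K w * T"
    by metis
  have "well_distributed nrm S"
    unfolding well_distributed_def
  proof (intro exI allI)
    fix x
    obtain z where z: "(\<Sum>v\<in>V. (z \<bullet> v) *\<^sub>R v) = x" using frame_surj[OF assms(1) span] by blast
    define y where "y = (\<Sum>v\<in>V. of_int \<lfloor>z \<bullet> v\<rfloor> *\<^sub>R v)"
    have "y \<in> S" unfolding S_def y_def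
      by (rule CollectI, rule exI[of _ "\<lambda>v. \<lfloor>z \<bullet> v\<rfloor>"], rule exI[of _ z]) (auto, linarith)
    obtain w where w: "w \<in> W" "nrm (x - y) = \<bar>(x - y) \<bullet> w\<bar>" using nrm by blast
    have "(x - y) \<bullet> w = (\<Sum>v\<in>V. (z \<bullet> v - of_int \<lfloor>z \<bullet> v\<rfloor>) * (v \<bullet> w))"
      by (simp add: y_def flip: z)
         (simp add: inner_sum_left inner_diff_left sum_subtractf algebra_simps)
    also have "\<bar>\<dots>\<bar> \<le> (\<Sum>v\<in>V. \<bar>(z \<bullet> v - of_int \<lfloor>z \<bullet> v\<rfloor>) * (v \<bullet> w)\<bar>)" by (rule sum_abs)
    also have "\<dots> \<le> (\<Sum>v\<in>V. \<bar>v \<bullet> w\<bar>)"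
      unfolding abs_mult by (intro sum_mono mult_left_le_one_le) (auto, linarith)
    \<comment> \<open>The form \<open>w\<close> depends on \<open>x\<close>; summing over all of
      \<open>W\<close> gives a uniform constant.\<close>
    also have "\<dots> \<le> (\<Sum>w\<in>W. \<Sum>v\<in>V. \<bar>v \<bullet> w\<bar>)"
      using member_le_sum[of w W "\<lambda>w. \<Sum>v\<in>V. \<bar>v \<bullet> w\<bar>"] w(1) assms(3) by (simp add: sum_nonneg)
    finally show "\<exists>y\<in>S. nrm (x - y) \<le> (\<Sum>w\<in>W. \<Sum>v\<in>V. \<bar>v \<bullet> w\<bar>)" using w(2) \<open>y \<in> S\<close> by (auto intro!: bexI[of _ y])
  qed
  moreover have sub: "dist_set nrm N S \<subseteq> (\<Union>w\<in>W. (\<lambda>r. \<bar>r\<bar> / 2) ` Y w (2 * real N))" for N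
  proof
    fix r assume "r \<in> dist_set nrm N S"
    then obtain a a' where a: "a \<in> S" "a' \<in> S" "r = nrm (a - a')" "r \<le> real N"
      unfolding dist_set_def by blast
    obtain x1 z1 where 1: "a = (\<Sum>v\<in>V. of_int (x1 v) *\<^sub>R v)" "\<And>v. v \<in> V \<Longrightarrow> \<bar>of_int (x1 v) - z1 \<bullet> v\<bar> \<le> 1"
      using a(1) unfolding S_def by blast
    obtain x2 z2 where 2: "a' = (\<Sum>v\<in>V. of_int (x2 v) *\<^sub>R v)" "\<And>v. v \<in> V \<Longrightarrow> \<bar>of_int (x2 v) - z2 \<bullet> v\<bar> \<le> 1"
      using a(2) unfolding S_def by blast
    define x where "x v = x1 v - x2 v" for v
    define z where "z = z1 - z2"
    have x: "\<bar>of_int (x v) - z \<bullet> v\<bar> \<le> 2" if "v \<in> V" for v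
      using 1(2)[OF that] 2(2)[OF that] by (simp add: x_def z_def inner_diff_left)
    obtain w where w: "w \<in> W" "r = \<bar>(a - a') \<bullet> w\<bar>" using nrm a(3) by blast
    \<comment> \<open>Antisymmetrizing cancels the part of \<open>z\<close> orthogonal to
      \<open>w\<close>: only the scalar \<open>t\<close> survives, so \<open>y\<close> is near a
      line rather than near a higher-dimensional subspace.\<close>
    define y where "y v = x v - x (reflection w v)" for v
    define t where "t = 2 * (z \<bullet> w) / (w \<bullet> w)"
    have yt: "\<bar>of_int (y v) - t * (v \<bullet> w)\<bar> \<le> 4" if "v \<in> V" for v
    proof -
      have "z \<bullet> v - z \<bullet> reflection w v = t * (v \<bullet> w)"
        by (simp add: reflection_def t_def inner_diff_right)
      then show ?thesis using x[OF that] x[OF refl[OF that w(1)]] by (simp add: y_def)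
    qed
    \<comment> \<open>The reflection permutes \<open>V\<close> and flips the sign of
      \<open>v \<bullet> w\<close>, so the mirrored half repeats the original sum. This is the
      factor 2 behind \<open>2 * real N\<close> and the division by 2.\<close>
    have "(\<Sum>v\<in>V. of_int (x (reflection w v)) * (v \<bullet> w)) = (\<Sum>v\<in>V. of_int (x v) * - (v \<bullet> w))"
      by (rule sum.reindex_bij_witness[of V "reflection w" "reflection w"])
         (auto simp: inner_reflection refl w(1))
    then have "(\<Sum>v\<in>V. of_int (y v) * (v \<bullet> w)) = 2 * (\<Sum>v\<in>V. of_int (x v) * (v \<bullet> w))"
      by (simp add: y_def left_diff_distrib sum_subtractf sum_negf)
    also have "(\<Sum>v\<in>V. of_int (x v) * (v \<bullet> w)) = (a - a') \<bullet> w"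
      by (simp add: 1 2 x_def inner_diff_left inner_sum_left left_diff_distrib sum_subtractf)
    finally have s: "(\<Sum>v\<in>V. of_int (y v) * (v \<bullet> w)) = 2 * ((a - a') \<bullet> w)" .
    have "2 * ((a - a') \<bullet> w) \<in> Y w (2 * real N)"
      unfolding Y_def
    proof (intro CollectI conjI exI)
      show "2 * ((a - a') \<bullet> w) = (\<Sum>v\<in>V. of_int (y v) * (v \<bullet> w))" using s ..
      show "\<forall>v\<in>V. \<bar>of_int (y v) - t * (v \<bullet> w)\<bar> \<le> 4" using yt by blast
      show "\<bar>2 * ((a - a') \<bullet> w)\<bar> \<le> 2 * real N" using w(2) a(4) by (simp add: abs_mult)
    qed
    then have "r \<in> (\<lambda>r. \<bar>r\<bar> / 2) ` Y w (2 * real N)"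
      using w(2) by (intro image_eqI) auto
    then show "r \<in> (\<Union>w\<in>W. (\<lambda>r. \<bar>r\<bar> / 2) ` Y w (2 * real N))" using w(1) by blast
  qed
  have fin: "finite (\<Union>w\<in>W. (\<lambda>r. \<bar>r\<bar> / 2) ` Y w (2 * real N))" if "N \<ge> 1" for N
    using K that assms(3) by simp
  have "finite (dist_set nrm N S)" if "N \<ge> 1" for N
    using sub fin[OF that] finite_subset by blast
  moreover have "real (card (dist_set nrm N S)) \<le> 2 * (\<Sum>w\<in>W. K w) * real N" if N: "N \<ge> 1" for N
  proof -
    have "card (dist_set nrm N S) \<le> card (\<Union>w\<in>W. (\<lambda>r. \<bar>r\<bar> / 2) ` Y w (2 * real N))"
      using sub fin[OF N] by (rule card_mono[rotated])
    also have "\<dots> \<le> (\<Sum>w\<in>W. card ((\<lambda>r. \<bar>r\<bar> / 2) ` Y w (2 * real N)))"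
      using assms(3) by (rule card_UN_le)
    also have "\<dots> \<le> (\<Sum>w\<in>W. card (Y w (2 * real N)))"
      using K N by (intro sum_mono card_image_le) auto
    finally have "real (card (dist_set nrm N S)) \<le> (\<Sum>w\<in>W. real (card (Y w (2 * real N))))"
      unfolding of_nat_sum[symmetric] by (rule of_nat_mono)
    also have "\<dots> \<le> (\<Sum>w\<in>W. K w * (2 * real N))" using K N by (intro sum_mono) auto
    finally show ?thesis by (simp add: sum_distrib_left sum_distrib_right algebra_simps)
  qed
  then have "(\<lambda>N. real (card (dist_set nrm N S))) \<in> O(\<lambda>N. real N)"
    by (intro bigoI[of _ "2 * (\<Sum>w\<in>W. K w)"] eventually_sequentiallyI[of 1]) simp
  ultimately show ?thesis by blast
qed

section \<open>Plane geometry of polygon edges\<close>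

text \<open>The anticlockwise quarter turn, which takes an edge vector to an edge normal.\<close>

definition rot :: "real^2 \<Rightarrow> real^2" where "rot a = vector [- a$2, a$1]"

text \<open>The determinant; its sign tells on which side of the line along \<open>a\<close> the
  vector \<open>b\<close> lies.\<close>

definition cross2 :: "real^2 \<Rightarrow> real^2 \<Rightarrow> real" where "cross2 a b = a$1 * b$2 - a$2 * b$1"

lemma rot_nth [simp]: "rot a $ 1 = - a$2" "rot a $ 2 = a$1"
  by (auto simp: rot_def)

lemma inner_real2: "a \<bullet> b = a$1 * b$1 + a$2 * b$2" for a b :: "real^2"
  by (simp add: inner_vec_def sum_2)

lemma vec_eq2: "a = b \<longleftrightarrow> a$1 = b$1 \<and> a$2 = b$2" for a b :: "real^2"
  by (simp add: vec_eq_iff forall_2)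

lemma inner_rot: "b \<bullet> rot a = cross2 a b"
  by (simp add: inner_real2 cross2_def)

text \<open>Faces of a polytope are exposed, so some linear form is maximal on \<open>P\<close>
  exactly along the edge. In the plane it is a multiple of \<open>cross2 (q - p)\<close>, and the
  point \<open>r\<close> off the edge fixes the sign.\<close>

lemma face_supporting_line:
  fixes P :: "(real^2) set"
  assumes P: "polytope P" and pq: "closed_segment p q face_of P" and qr: "closed_segment q r face_of P"
    and ne: "p \<noteq> q" "p \<noteq> r" "q \<noteq> r"
  shows "cross2 (q - p) (r - p) \<noteq> 0"
    and "\<And>y. y \<in> P \<Longrightarrow> cross2 (q - p) (y - p) * cross2 (q - p) (r - p) \<ge> 0"
proof -
  have in_P: "p \<in> P" "q \<in> P" "r \<in> P"
    using face_of_imp_subset[OF pq] face_of_imp_subset[OF qr] by auto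
  have r: "r \<notin> closed_segment p q"
  proof
    assume "r \<in> closed_segment p q"
    then have "r \<in> open_segment p q" using ne by (auto simp: open_segment_def)
    \<comment> \<open>A face containing the inner point \<open>r\<close> of the segment from
      \<open>p\<close> to \<open>q\<close> contains both ends. Then \<open>p\<close> and
      \<open>r\<close> each lie between \<open>q\<close> and the other, which forces
      \<open>p = r\<close>.\<close>
    then have "p \<in> closed_segment q r"
      using qr in_P unfolding face_of_def by (meson ends_in_segment)
    then show False using \<open>r \<in> closed_segment p q\<close> ne
      by (metis between_antisym between_commute between_mem_segment)
  qed
  obtain a b where ab: "P \<subseteq> {x. a \<bullet> x \<le> b}" "closed_segment p q = P \<inter> {x. a \<bullet> x = b}"
    using exposed_face_of_polyhedron[OF polytope_imp_polyhedron[OF P]] pq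
    unfolding exposed_face_of_def by blast
  define d where "d = q - p"
  have eq: "a \<bullet> p = b" "a \<bullet> q = b" using ab(2) ends_in_segment by blast+
  then have ad: "a \<bullet> d = 0" by (simp add: d_def inner_diff_right)
  have d: "d \<bullet> d > 0" using ne by (simp add: d_def)
  \<comment> \<open>As \<open>a\<close> is orthogonal to \<open>d\<close>, it is parallel to
    \<open>rot d\<close>; this is the planar Lagrange identity with its remaining term zero.\<close>
  have key: "(d \<bullet> d) * (a \<bullet> y) = cross2 d a * cross2 d y" for y
  proof -
    have "(d \<bullet> d) * (a \<bullet> y) - cross2 d a * cross2 d y = (a \<bullet> d) * (d \<bullet> y)"
      by (simp add: inner_real2 cross2_def algebra_simps)
    then show ?thesis using ad by simp
  qed
  have le: "cross2 d a * cross2 d (y - p) \<le> 0" if "y \<in> P" for y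
  proof -
    have "a \<bullet> (y - p) \<le> 0" using ab(1) that eq by (auto simp: inner_diff_right)
    then show ?thesis using key[of "y - p"] d by (metis mult_nonneg_nonpos less_imp_le)
  qed
  have "a \<bullet> r \<noteq> b" using ab(2) r in_P by blast
  then have "a \<bullet> (r - p) < 0" using ab(1) in_P eq by (force simp: inner_diff_right)
  then have lt: "cross2 d a * cross2 d (r - p) < 0" 
    using key[of "r - p"] d by (metis mult_pos_neg)
  then show "cross2 (q - p) (r - p) \<noteq> 0" by (auto simp: d_def)
  show "cross2 (q - p) (y - p) * cross2 (q - p) (r - p) \<ge> 0" if "y \<in> P" for y
    using le[OF that] lt unfolding d_def by (auto simp: mult_less_0_iff mult_le_0_iff zero_le_mult_iff)
qed

text \<open>Each edge arises from the previous one by the same rotation, and a reflection turns a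
  rotation into its inverse. The mirror line is spanned by \<open>D k\<close>, which stays fixed, so
  steps forward from \<open>k\<close> become steps backward.\<close>

lemma reflection_edges:
  fixes D :: "int \<Rightarrow> real^2"
  assumes len: "\<And>i. D i \<bullet> D i = s" and s: "s \<noteq> 0"
    and inn: "\<And>i. D i \<bullet> D (i + 1) = c" and cr: "\<And>i. cross2 (D i) (D (i + 1)) = e"
  shows "reflection (rot (D k)) (D (k + m)) = D (k - m)"
proof -
  have up: "s *\<^sub>R D (i + 1) = c *\<^sub>R D i + e *\<^sub>R rot (D i)" for i
    unfolding len[of i, symmetric] inn[of i, symmetric] cr[of i, symmetric]
    by (simp add: vec_eq2 inner_real2 cross2_def algebra_simps)
  have down: "s *\<^sub>R D i = c *\<^sub>R D (i + 1) - e *\<^sub>R rot (D (i + 1))" for i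
    unfolding len[of "i + 1", symmetric] inn[of i, symmetric] cr[of i, symmetric]
    by (simp add: vec_eq2 inner_real2 cross2_def algebra_simps)
  \<comment> \<open>Reflections anticommute with the quarter turn. Below, \<open>Q\<close> is
    \<open>s\<close> times the reflection, so that the identity becomes polynomial.\<close>
  have R: "reflection (rot (D k)) (a *\<^sub>R x + b *\<^sub>R rot x) =
      a *\<^sub>R reflection (rot (D k)) x - b *\<^sub>R rot (reflection (rot (D k)) x)" for a b x
  proof -
    define u where "u = D k"
    define Q where "Q y = (u \<bullet> u) *\<^sub>R y - (2 * (y \<bullet> rot u)) *\<^sub>R rot u" for y
    have "Q (a *\<^sub>R x + b *\<^sub>R rot x) = a *\<^sub>R Q x - b *\<^sub>R rot (Q x)"
      by (simp add: Q_def vec_eq2 inner_real2 algebra_simps)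
    moreover have "reflection (rot u) y = (1 / s) *\<^sub>R Q y" for y
    proof -
      have "rot u \<bullet> rot u = s" "u \<bullet> u = s" using len[of k] by (simp_all add: u_def inner_real2)
      then show ?thesis using s by (simp add: reflection_def Q_def scaleR_diff_right)
    qed
    moreover have "rot (r *\<^sub>R y) = r *\<^sub>R rot y" for r y by (simp add: vec_eq2)
    ultimately show ?thesis by (simp add: u_def scaleR_diff_right mult.commute)
  qed
  have L: "reflection w (s *\<^sub>R x) = s *\<^sub>R reflection w x" for w x :: "real^2"
    by (simp add: reflection_def scaleR_diff_right)
  show ?thesis
  proof (induction m rule: int_induct[of _ 0])
    case base
    show ?case by (simp add: reflection_def inner_real2)
  next
    case (step1 m)
    have "s *\<^sub>R reflection (rot (D k)) (D (k + (m + 1))) = s *\<^sub>R D (k - m - 1)"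
      using up[of "k + m"] down[of "k - m - 1"] R[of c "D (k + m)" e] step1(2)
      unfolding L[symmetric] by (simp add: add.assoc)
    then show ?case using s by (simp add: algebra_simps)
  next
    case (step2 m)
    have "s *\<^sub>R reflection (rot (D k)) (D (k + m - 1)) = s *\<^sub>R D (k - m + 1)"
      using up[of "k - m"] down[of "k + m - 1"] R[of c "D (k + m)" "- e"] step2(2)
      unfolding L[symmetric] by simp
    then show ?case using s by (simp add: algebra_simps)
  qed
qed

section \<open>From the definition of a regular polygon to constant edge length, inner product and
  turn\<close>

text \<open>The vertices are indexed by the integers, periodically, so that no case distinction is
  needed at the wrap-around.\<close>

lemma regular_polygon_periodic:
  assumes "regular_polygon P"
  obtains n :: int and V :: "int \<Rightarrow> real^2" and s c e where
    "n \<ge> 1" "\<And>i. V (i mod n) = V i" "\<And>i. V (i + 1) = V (i mod n + 1)"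
    "P = convex hull (range V)"
    "\<And>i. (V (i + 1) - V i) \<bullet> (V (i + 1) - V i) = s"
    "\<And>i. (V (i + 1) - V i) \<bullet> (V (i + 2) - V (i + 1)) = c"
    "\<And>i. cross2 (V (i + 1) - V i) (V (i + 2) - V (i + 1)) = e" "s > 0" "e \<noteq> 0"
    "\<And>i y. y \<in> P \<Longrightarrow> e * cross2 (V (i + 1) - V i) (y - V i) \<ge> 0"
proof -
  obtain m v s \<theta> where m: "m \<ge> 3" and inj: "inj_on v {..<m}" and P: "P = convex hull (v ` {..<m})"
    and edge: "\<And>i. i < m \<Longrightarrow> closed_segment (v i) (v (Suc i mod m)) edge_of P"
    and dist: "\<And>i. i < m \<Longrightarrow> dist (v i) (v (Suc i mod m)) = s"
    and angle: "\<And>i. i < m \<Longrightarrow> angle_at (v i) (v (Suc i mod m)) (v (Suc (Suc i) mod m)) = \<theta>"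
    using assms unfolding regular_polygon_def convex_polygon_def by blast
  define V where "V i = v (nat (i mod int m))" for i
  have V_mod: "V (i mod int m) = V i" for i by (simp add: V_def)
  have V_mod1: "V (i + 1) = V (i mod int m + 1)" for i by (simp add: V_def mod_add_left_eq)
  have less: "nat (i mod int m) < m" for i using m by (simp add: nat_less_iff)
  have Suc: "V (i + 1) = v (Suc (nat (i mod int m)) mod m)" for i
  proof -
    have "int (Suc (nat (i mod int m)) mod m) = (i + 1) mod int m"
      using m by (simp add: zmod_int mod_simps add.commute)
    then show ?thesis unfolding V_def by (metis nat_int)
  qed
  have Suc2: "V (i + 2) = v (Suc (Suc (nat (i mod int m))) mod m)" for i
  proof -
    have "int (Suc (Suc (nat (i mod int m))) mod m) = (i + 2) mod int m"
      using m by (simp add: zmod_int mod_simps add.commute)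
    then show ?thesis unfolding V_def by (metis nat_int)
  qed
  have ne: "V i \<noteq> V (i + k)" if "0 < k" "k < int m" for i k
  proof
    assume "V i = V (i + k)"
    then have "nat (i mod int m) = nat ((i + k) mod int m)"
      using inj less unfolding V_def inj_on_def by blast
    then have "i mod int m = (i + k) mod int m" using m by (simp add: eq_nat_nat_iff)
    then have "int m dvd (i + k) - i" by (metis mod_eq_dvd_iff)
    then show False using that zdvd_not_zless by auto
  qed
  have rangeV: "range V = v ` {..<m}"
  proof (intro equalityI subsetI)
    fix x assume "x \<in> v ` {..<m}"
    then obtain i where "i < m" "x = v i" by blast
    then have "x = V (int i)" by (simp add: V_def)
    then show "x \<in> range V" by blast
  qed (use less in \<open>auto simp: V_def\<close>)
  have face: "closed_segment (V i) (V (i + 1)) face_of P" for i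
    using edge[OF less[of i]] unfolding Suc edge_of_def by (simp add: V_def)
  have poly: "polytope P" unfolding P by (simp add: polytope_convex_hull)
  define D where "D i = V (i + 1) - V i" for i
  define E where "E i = cross2 (D i) (D (i + 1))" for i
  have Dne: "D i \<noteq> 0" for i using ne[of 1 i] m by (auto simp: D_def)
  have normD: "norm (D i) = s" for i
    using dist[OF less[of i]] unfolding Suc[symmetric] by (simp add: D_def V_def dist_norm norm_minus_commute)
  have s: "s > 0" using normD[of 0] Dne[of 0] by (metis zero_less_norm_iff)
  have D2: "D (i + 1) = V (i + 2) - V (i + 1)" for i by (simp add: D_def add.assoc)
  have line: "E i \<noteq> 0" "\<And>y. y \<in> P \<Longrightarrow> cross2 (D i) (y - V i) * E i \<ge> 0" for i
  proof -
    have E: "E i = cross2 (D i) (V (i + 2) - V i)"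
      by (simp add: E_def D2) (simp add: D_def cross2_def algebra_simps)
    have f2: "closed_segment (V (i + 1)) (V (i + 2)) face_of P"
      using face[of "i + 1"] by (simp add: add.assoc)
    have ne': "V i \<noteq> V (i + 1)" "V i \<noteq> V (i + 2)" "V (i + 1) \<noteq> V (i + 2)"
      using ne[of 1 i] ne[of 2 i] ne[of 1 "i + 1"] m by (auto simp: add.assoc)
    show "E i \<noteq> 0" "\<And>y. y \<in> P \<Longrightarrow> cross2 (D i) (y - V i) * E i \<ge> 0"
      using face_supporting_line[OF poly face[of i] f2 ne'] unfolding E by (auto simp: D_def)
  qed
  have VP: "V i \<in> P" for i unfolding P rangeV[symmetric] by (rule hull_inc) simp
  \<comment> \<open>The polygon lies on one side of the line of edge \<open>i + 1\<close>; testing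
    this with the vertex \<open>V i\<close> compares two consecutive turns.\<close>
  have pos: "E i * E (i + 1) > 0" for i
  proof -
    have "cross2 (D (i + 1)) (V i - V (i + 1)) = E i"
      by (simp add: E_def) (simp add: D_def cross2_def algebra_simps)
    then have "E i * E (i + 1) \<ge> 0" using line(2)[of "V i" "i + 1"] VP by simp
    then show ?thesis using line(1) by (metis less_eq_real_def mult_eq_0_iff)
  qed
  \<comment> \<open>\<open>arccos\<close> is injective on \<open>[-1, 1]\<close>, so equal angles
    and lengths give equal inner products. The minus sign below arises because one ray of the angle
    points along \<open>- D j\<close>.\<close>
  have inn: "D i \<bullet> D (i + 1) = D 0 \<bullet> D 1" for i
  proof -
    have a: "arccos (- (D j \<bullet> D (j + 1)) / (s * s)) = \<theta>" for j
    proof -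
      have "angle_at (V j) (V (j + 1)) (V (j + 2)) = \<theta>"
        using angle[OF less[of j]] unfolding Suc[symmetric] Suc2[symmetric] by (simp add: V_def)
      moreover have "V j - V (j + 1) = - D j" by (simp add: D_def)
      ultimately show ?thesis unfolding angle_at_def D2[symmetric] by (simp add: normD)
    qed
    have "\<bar>- (D j \<bullet> D (j + 1)) / (s * s)\<bar> \<le> 1" for j
      using Cauchy_Schwarz_ineq2[of "D j" "D (j + 1)"] s by (simp add: normD)
    then have "- (D i \<bullet> D (i + 1)) / (s * s) = - (D 0 \<bullet> D (0 + 1)) / (s * s)"
      using a[of i] a[of 0] by (metis arccos_eq_iff)
    then show ?thesis using s by simp
  qed
  \<comment> \<open>Lagrange's identity fixes \<open>E i\<close> up to sign, and \<open>pos\<close>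
    then settles the sign.\<close>
  have "(E i)\<^sup>2 = (s * s)\<^sup>2 - (D 0 \<bullet> D 1)\<^sup>2" for i
  proof -
    have "(E i)\<^sup>2 = (D i \<bullet> D i) * (D (i + 1) \<bullet> D (i + 1)) - (D i \<bullet> D (i + 1))\<^sup>2"
      by (simp add: E_def cross2_def inner_real2 power2_eq_square algebra_simps)
    then show ?thesis using inn[of i] normD by (simp add: dot_square_norm power2_eq_square)
  qed
  then have "E i = E (i + 1)" for i
    using pos[of i] by (metis mult_minus_left not_less_iff_gr_or_eq power2_eq_iff
        zero_less_mult_iff mult_minus_right neg_0_less_iff_less)
  then have E0: "E i = E 0" for i
    by (induction i rule: int_induct[of _ 0]) (simp, metis, metis diff_add_cancel)
  show thesis
  proof (rule that[of "int m" V "s * s" "D 0 \<bullet> D 1" "E 0"])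
    show "P = convex hull (range V)" using P rangeV by simp
    show "(V (i + 1) - V i) \<bullet> (V (i + 1) - V i) = s * s" for i
      using normD[of i] by (simp add: D_def dot_square_norm power2_eq_square)
    show "(V (i + 1) - V i) \<bullet> (V (i + 2) - V (i + 1)) = D 0 \<bullet> D 1" for i
      using inn[of i] by (simp add: D2) (simp add: D_def)
    show "cross2 (V (i + 1) - V i) (V (i + 2) - V (i + 1)) = E 0" for i
      using E0[of i] by (simp add: E_def D2) (simp add: D_def)
    show "E 0 * cross2 (V (i + 1) - V i) (y - V i) \<ge> 0" if "y \<in> P" for i y
      using line(2)[OF that, of i] E0[of i] by (simp add: D_def mult.commute)
  qed (use m s line V_mod V_mod1 in auto)
qed

section \<open>The norm as one of the edge forms\<close>

text \<open>Otherwise one nonnegative value makes all later values positive, and periodicity carries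
  this back to every index.\<close>

lemma periodic_sign_change:
  fixes f :: "int \<Rightarrow> real"
  assumes n: "n \<ge> 1" and per: "\<And>i. f (i mod n) = f i"
    and "\<not> (\<forall>i. f i > 0)" "\<not> (\<forall>i. f i < 0)"
  shows "\<exists>i. f i \<ge> 0 \<and> f (i + 1) \<le> 0"
proof (rule ccontr)
  assume neg: "\<not> ?thesis"
  then have step: "f (i + 1) > 0" if "f i \<ge> 0" for i using that neg by (meson not_le)
  obtain k where k: "f k \<ge> 0" using assms(4) not_le by blast
  have later: "f j \<ge> 0" if "j \<ge> k" for j
    using that by (induction j rule: int_ge_induct) (use k step in \<open>auto intro: less_imp_le\<close>)
  have "f j > 0" for j
  proof -
    define a where "a = \<bar>j\<bar> + \<bar>k\<bar> + 1"
    define l where "l = j + n * a"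
    have "1 * a \<le> n * a" using n by (intro mult_right_mono) (auto simp: a_def)
    then have "k \<le> l - 1" unfolding l_def using a_def by linarith
    then have "f l > 0" using step[OF later, of "l - 1"] by simp
    moreover have "l mod n = j mod n" by (simp add: l_def)
    ultimately show ?thesis using per by metis
  qed
  then show False using assms(3) by blast
qed

text \<open>The form of edge \<open>i\<close>, scaled to be 1 on that edge, is at most 1 on the ball
  and so at most \<open>nrm\<close> everywhere. Equality holds on the cone over the edge, and every
  \<open>x\<close> lies in such a cone.\<close>

lemma unit_ball_polygon_norm:
  fixes V :: "int \<Rightarrow> real^2"
  assumes norm: "is_norm nrm"
    and n: "n \<ge> 1" and per: "\<And>i. V (i mod n) = V i"
    and P: "unit_ball nrm = convex hull (range V)"
    and cr: "\<And>i. cross2 (V (i + 1) - V i) (V (i + 2) - V (i + 1)) = e" and e: "e \<noteq> 0"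
    and side: "\<And>i y. nrm y \<le> 1 \<Longrightarrow> e * cross2 (V (i + 1) - V i) (y - V i) \<ge> 0"
  shows "cross2 (V (i + 1) - V i) (V i) \<noteq> 0"
    and "\<exists>i. nrm x = cross2 (V (i + 1) - V i) x / cross2 (V (i + 1) - V i) (V i)"
proof -
  have nrm: "nrm 0 = 0" "\<And>x. nrm x \<ge> 0" "\<And>x. nrm x = 0 \<Longrightarrow> x = 0" "\<And>a x. nrm (a *\<^sub>R x) = \<bar>a\<bar> * nrm x"
    "\<And>x y. nrm (x + y) \<le> nrm x + nrm y"
    using norm unfolding is_norm_def by blast+
  define D where "D i = V (i + 1) - V i" for i
  define c where "c i = cross2 (D i) (V i)" for i
  have V1: "nrm (V i) \<le> 1" for i
    using hull_subset[of "range V" convex] unfolding P[symmetric] unit_ball_def by blast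
  have ge: "e * cross2 (D i) y \<ge> e * c i" if "nrm y \<le> 1" for i y
    using side[OF that, of i] by (simp add: D_def c_def cross2_def algebra_simps)
  have ec: "e * c i < 0" for i
  proof -
    have "e * c i \<le> 0" using ge[of 0 i] nrm(1) by (simp add: cross2_def)
    \<comment> \<open>If the line of the edge passed through the origin, \<open>V (i + 2)\<close>
      would be strictly on one side of it and its negative, also in the ball, strictly on the
      other.\<close>
    moreover have "e * c i \<noteq> 0"
    proof
      assume 0: "e * c i = 0"
      have "cross2 (D i) (V (i + 2)) = e + c i"
        using cr[of i] by (simp add: D_def c_def cross2_def algebra_simps)
      moreover have "nrm (- V (i + 2)) \<le> 1" using nrm(4)[of "-1" "V (i + 2)"] V1 by simp
      then have "e * cross2 (D i) (- V (i + 2)) \<ge> 0" using ge 0 by metis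
      moreover have "cross2 (D i) (- V (i + 2)) = - cross2 (D i) (V (i + 2))"
        by (simp add: cross2_def)
      ultimately have "e * e \<le> 0" using 0 by (simp add: algebra_simps)
      then show False using e by (metis not_real_square_gt_zero not_le)
    qed
    ultimately show ?thesis by linarith
  qed
  then show "cross2 (V (i + 1) - V i) (V i) \<noteq> 0" by (metis D_def c_def less_irrefl mult_zero_right)
  have le1: "cross2 (D i) y / c i \<le> 1" if "nrm y \<le> 1" for i y
  proof -
    have "e * cross2 (D i) y / (e * c i) \<le> 1"
      using ge[OF that, of i] ec[of i] by (subst neg_divide_le_eq) auto
    then show ?thesis using e by simp
  qed
  have le: "cross2 (D i) y / c i \<le> nrm y" for i y
  proof (cases "y = 0")
    case True
    then show ?thesis using nrm(1) by (simp add: cross2_def)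
  next
    case False
    then have pos: "nrm y > 0" using nrm(2,3) by (metis less_eq_real_def)
    have "nrm ((1 / nrm y) *\<^sub>R y) \<le> 1" using pos nrm(4) by simp
    from le1[OF this, of i] have "cross2 (D i) y / nrm y / c i \<le> 1"
      by (simp add: cross2_def algebra_simps diff_divide_distrib)
    then have "(cross2 (D i) y / c i) / nrm y \<le> 1" by (simp add: mult.commute)
    then show ?thesis using pos by (simp only: pos_divide_le_eq mult_1)
  qed
  define f where "f i = e * cross2 (V i) x" for i
  \<comment> \<open>The origin is in the hull of the vertices, so they cannot all be strictly on one
    side of the line through 0 and \<open>x\<close>; hence \<open>f\<close> changes sign.\<close>
  have half: "0 \<in> H" if "convex H" "range V \<subseteq> H" for H
  proof -
    have "unit_ball nrm \<subseteq> H" unfolding P using that by (intro hull_minimal)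
    then show ?thesis using nrm(1) by (auto simp: unit_ball_def)
  qed
  define w where "w = - (e *\<^sub>R rot x)"
  have fw: "f i = w \<bullet> V i" for i
    by (simp add: w_def f_def inner_real2 cross2_def algebra_simps)
  have "\<not> (\<forall>i. f i > 0)"
    using half[OF convex_halfspace_gt[of 0 w]] by (auto simp: fw)
  moreover have "\<not> (\<forall>i. f i < 0)"
    using half[OF convex_halfspace_lt[of w 0]] by (auto simp: fw)
  moreover have "f (i mod n) = f i" for i by (simp add: f_def per)
  ultimately obtain i where i: "f i \<ge> 0" "f (i + 1) \<le> 0"
    using periodic_sign_change[OF n, of f] by metis
  define p q where "p = V i" and "q = V (i + 1)"
  \<comment> \<open>Cramer's rule: the coordinates of \<open>x\<close> with respect to
    \<open>p\<close> and \<open>q\<close>. The sign change makes both nonnegative, so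
    \<open>x\<close> is in the cone over this edge.\<close>
  define a b where "a = cross2 x q / cross2 p q" and "b = cross2 p x / cross2 p q"
  have pq: "cross2 p q = - c i" by (simp add: c_def D_def p_def q_def cross2_def algebra_simps)
  then have epq: "e * cross2 p q > 0" using ec[of i] by simp
  have "e * cross2 x q / (e * cross2 p q) \<ge> 0"
    using i(2) epq by (intro divide_nonneg_pos) (auto simp: f_def q_def cross2_def algebra_simps)
  then have a: "a \<ge> 0" using e by (simp add: a_def)
  have "e * cross2 p x / (e * cross2 p q) \<ge> 0"
    using i(1) epq by (intro divide_nonneg_pos) (auto simp: f_def p_def)
  then have b: "b \<ge> 0" using e by (simp add: b_def)
  have ne: "cross2 p q \<noteq> 0" using epq by auto
  have "cross2 p q *\<^sub>R x = cross2 x q *\<^sub>R p + cross2 p x *\<^sub>R q"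
    by (simp add: vec_eq2 cross2_def algebra_simps)
  then have "(1 / cross2 p q) *\<^sub>R (cross2 p q *\<^sub>R x) = a *\<^sub>R p + b *\<^sub>R q"
    by (simp add: a_def b_def scaleR_add_right)
  then have x: "x = a *\<^sub>R p + b *\<^sub>R q" using ne by simp
  have "nrm x \<le> a * nrm p + b * nrm q"
    using nrm(5)[of "a *\<^sub>R p" "b *\<^sub>R q"] a b by (simp add: x nrm(4))
  also have "\<dots> \<le> a * 1 + b * 1"
    using a b V1 by (intro add_mono mult_left_mono) (auto simp: p_def q_def)
  also have "\<dots> = cross2 (D i) x / c i"
  proof -
    have "cross2 (D i) x = (a + b) * c i"
      by (simp add: x c_def D_def p_def q_def cross2_def algebra_simps)
    moreover have "c i \<noteq> 0" using ne pq by simp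
    ultimately show ?thesis by simp
  qed
  finally show "\<exists>i. nrm x = cross2 (V (i + 1) - V i) x / cross2 (V (i + 1) - V i) (V i)"
    using le[of i x] unfolding D_def c_def by (intro exI[of _ i]) linarith
qed

section \<open>Applying the counting argument to edge vectors and scaled normals\<close>

lemma finite_range_periodic:
  fixes F :: "int \<Rightarrow> 'a"
  assumes "n \<ge> 1" "\<And>i. F (i mod n) = F i"
  shows "finite (range F)"
proof -
  have "range F \<subseteq> F ` {0..<n}"
  proof
    fix x assume "x \<in> range F"
    then obtain i where "x = F (i mod n)" using assms(2) by auto
    then show "x \<in> F ` {0..<n}" using assms(1) by auto
  qed
  then show ?thesis using finite_surj by blast
qed

theorem corollary2:
  fixes nrm :: "real^2 \<Rightarrow> real"
  assumes "is_norm nrm"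
    and "regular_polygon (unit_ball nrm)"
  shows "\<exists>S. well_distributed nrm S \<and>
           (\<forall>N\<ge>1. finite (dist_set nrm N S)) \<and>
           (\<lambda>N. real (card (dist_set nrm N S))) \<in> O(\<lambda>N. real N)"
proof (rule regular_polygon_periodic[OF assms(2)])
  fix n :: int and V :: "int \<Rightarrow> real^2" and s c e :: real
  assume V: "n \<ge> 1" "\<And>i. V (i mod n) = V i" "\<And>i. V (i + 1) = V (i mod n + 1)"
    "unit_ball nrm = convex hull (range V)"
    "\<And>i. (V (i + 1) - V i) \<bullet> (V (i + 1) - V i) = s"
    "\<And>i. (V (i + 1) - V i) \<bullet> (V (i + 2) - V (i + 1)) = c"
    "\<And>i. cross2 (V (i + 1) - V i) (V (i + 2) - V (i + 1)) = e" "s > 0" "e \<noteq> 0"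
    "\<And>i y. y \<in> unit_ball nrm \<Longrightarrow> e * cross2 (V (i + 1) - V i) (y - V i) \<ge> 0"
  note norm = unit_ball_polygon_norm[OF assms(1) V(1,2,4,7,9) V(10)[unfolded unit_ball_def mem_Collect_eq]]
  define D where "D i = V (i + 1) - V i" for i
  define h where "h i = cross2 (D i) (V i)" for i
  have h: "h i \<noteq> 0" for i using norm(1) by (simp add: h_def D_def)
  have D_mod: "D (i mod n) = D i" for i using V(2)[of i] V(3)[of i] by (simp add: D_def)
  have D1: "D (i + 1) = V (i + 2) - V (i + 1)" for i by (simp add: D_def add.assoc)
  have s: "D i \<bullet> D i = s" for i using V(5) by (simp add: D_def)
  have cr: "cross2 (D i) (D (i + 1)) = e" for i using V(7) unfolding D1 by (simp add: D_def)
  have inn: "D i \<bullet> D (i + 1) = c" for i using V(6) unfolding D1 by (simp add: D_def)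
  show ?thesis
  proof (rule reflection_invariant_distances)
    show "finite (range D)" using V(1) D_mod by (rule finite_range_periodic)
    show "finite (range (\<lambda>i. (1 / h i) *\<^sub>R rot (D i)))"
      using V(1,2) D_mod by (intro finite_range_periodic[of n]) (auto simp: h_def)
    show "0 \<notin> range (\<lambda>i. (1 / h i) *\<^sub>R rot (D i))"
    proof
      assume "0 \<in> range (\<lambda>i. (1 / h i) *\<^sub>R rot (D i))"
      then obtain i where "rot (D i) = 0" using h by auto
      then have "D i \<bullet> D i = 0" by (simp add: vec_eq2 inner_real2)
      then show False using s V(8) by simp
    qed
    show "z = 0" if "\<And>v. v \<in> range D \<Longrightarrow> z \<bullet> v = 0" for z
    proof -
      have "z \<bullet> D 0 = 0" "z \<bullet> D 1 = 0" using that by auto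
      \<comment> \<open>Two consecutive edges already span the plane, because their determinant is
        \<open>e\<close>.\<close>
      moreover have "cross2 (D 0) (D 1) *\<^sub>R z = (z \<bullet> D 1) *\<^sub>R rot (D 0) - (z \<bullet> D 0) *\<^sub>R rot (D 1)"
        by (simp add: vec_eq2 cross2_def inner_real2 algebra_simps)
      ultimately show "z = 0" using cr[of 0] V(9) by simp
    qed
    show "reflection w v \<in> range D" if vw: "v \<in> range D" "w \<in> range (\<lambda>i. (1 / h i) *\<^sub>R rot (D i))" for v w
    proof -
      obtain j k where jk: "v = D j" "w = (1 / h k) *\<^sub>R rot (D k)" using vw by blast
      \<comment> \<open>Scaling the normal leaves the reflection unchanged, so edge \<open>j\<close>
        goes to edge \<open>2 * k - j\<close>.\<close>
      have "reflection w v = D (k - (j - k))"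
        using reflection_edges[of D s c e k "j - k", OF s _ inn cr] V(8) h[of k]
        by (simp add: jk reflection_scaleR)
      then show ?thesis by simp
    qed
    show "\<exists>w\<in>range (\<lambda>i. (1 / h i) *\<^sub>R rot (D i)). nrm x = \<bar>x \<bullet> w\<bar>" for x
    proof -
      obtain i where "nrm x = cross2 (D i) x / h i" using norm(2)[of x] by (auto simp: h_def D_def)
      moreover have "nrm x \<ge> 0" using assms(1) by (simp add: is_norm_def)
      ultimately have "nrm x = \<bar>cross2 (D i) x / h i\<bar>" by (metis abs_of_nonneg)
      then have "nrm x = \<bar>x \<bullet> ((1 / h i) *\<^sub>R rot (D i))\<bar>" by (simp add: inner_rot)
      then show ?thesis by blast
    qed
  qed
qed

end
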